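(* Let $\Gamma$ be a locally finite graph, $F$ a field with an absolute value $|\cdot|_{\rm v}$, and $v\in V(\Gamma)$. Let $\lambda\in F$ and suppose that $\Gamma$ has an $(F,\lambda)$-propagator with finite support with respect to $v$. Then there is a finite subset $X$ of $V(\Gamma)$ containing $v$ such that for every finite subset $X'$ of $V(\Gamma)$ containing $X$ either the determinant of the matrix $\mathbf{A}_{\langle X'\rangle_\Gamma,F}-\lambda\mathbf{E}$ is zero, or all minors of this matrix obtained by deleting the row corresponding to $v$ and the column corresponding to any of the vertices of $X'\setminus X$ are zero.
   Context: A graph is an undirected graph without loops or multiple edges, with vertex set $V(\Gamma)$; $\Gamma(v)$ is the set of vertices adjacent to $v$. $\Gamma$ is locally finite if every $\Gamma(v)$ is finite. $F^{V(\Gamma)}$ is the $F$-vector space of all functions $V(\Gamma)\to F$, and $A_{\Gamma,F}$ is the linear operator on it given by $(A_{\Gamma,F}(f))(v)=\sum_{u\in\Gamma(v)}f(u)$; $E$ is the identity operator. The absolute value may be trivial. The support of $f$ is $\{u: f(u)\neq 0\}$. $\delta_v$ is the function equal to $1$ at $v$ and $0$ elsewhere. An $(F,\lambda)$-propagator of $\Gamma$ with respect to $v$ is any $f\in F^{V(\Gamma)}$ with $(A_{\Gamma,F}-\lambda E)(f)=\delta_v$. $\langle X'\rangle_\Gamma$ is the subgraph of $\Gamma$ induced by $X'$; for a graph $\Delta$, $\mathbf{A}_{\Delta,F}$ is the matrix over $F$ indexed by $V(\Delta)\times V(\Delta)$ with $(u,w)$ entry $1$ if $u,w$ are adjacent and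 $0$ otherwise; $\mathbf{E}$ is the identity matrix. *)

theory Defs
  imports
    "HOL-Library.FuncSet"
    "Graph_Theory.Digraph_Component"
    "Jordan_Normal_Form.Determinant"
begin

(* As in Graph_Theory, an undirected graph is a symmetric digraph; this is the library locale
   "graph" without its finiteness requirement.  An edge {u, w} is the pair of arcs u -> w, w -> u. *)
locale simple_graph = loopfree_digraph + nomulti_digraph + sym_digraph

definition neighbours :: "('a, 'b) pre_digraph \<Rightarrow> 'a \<Rightarrow> 'a set" where
  "neighbours G v = {u \<in> verts G. v \<rightarrow>\<^bsub>G\<^esub> u}"

locale locally_finite_graph = simple_graph +
  assumes finite_neighbours: "v \<in> verts G \<Longrightarrow> finite (neighbours G v)"

locale absolute_value =
  fixes absv :: "'f::field \<Rightarrow> real"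
  assumes absv_nonneg: "absv x \<ge> 0"
    and absv_eq_0_iff: "absv x = 0 \<longleftrightarrow> x = 0"
    and absv_mult: "absv (x * y) = absv x * absv y"
    and absv_triangle: "absv (x + y) \<le> absv x + absv y"

(* Functions on the vertex set are extensional, i.e. undefined outside verts G, so that
   equality in HOL is equality of functions on verts G. *)
definition vertex_funs :: "('a, 'b) pre_digraph \<Rightarrow> ('a \<Rightarrow> 'f) set" where
  "vertex_funs G = verts G \<rightarrow>\<^sub>E UNIV"

definition adj_op :: "('a, 'b) pre_digraph \<Rightarrow> ('a \<Rightarrow> 'f::field) \<Rightarrow> 'a \<Rightarrow> 'f" where
  "adj_op G f = (\<lambda>v\<in>verts G. \<Sum>u\<in>neighbours G v. f u)"

definition delta :: "('a, 'b) pre_digraph \<Rightarrow> 'a \<Rightarrow> 'a \<Rightarrow> 'f::field" where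
  "delta G v = (\<lambda>u\<in>verts G. if u = v then 1 else 0)"

definition supp :: "('a, 'b) pre_digraph \<Rightarrow> ('a \<Rightarrow> 'f::field) \<Rightarrow> 'a set" where
  "supp G f = {u \<in> verts G. f u \<noteq> 0}"

definition propagator ::
    "('a, 'b) pre_digraph \<Rightarrow> 'f::field \<Rightarrow> 'a \<Rightarrow> ('a \<Rightarrow> 'f) \<Rightarrow> bool" where
  "propagator G lam v f \<longleftrightarrow>
     f \<in> vertex_funs G \<and> (\<lambda>u\<in>verts G. adj_op G f u - lam * f u) = delta G v"

(* Library matrices have indices 0..<n, so a matrix indexed by a finite vertex set is written
   down along an enumeration xs of that set: row and column i belong to the vertex xs ! i. *)
definition enumerates :: "'a list \<Rightarrow> 'a set \<Rightarrow> bool" where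
  "enumerates xs S \<longleftrightarrow> distinct xs \<and> set xs = S"

definition adj_matrix :: "('a, 'b) pre_digraph \<Rightarrow> 'a list \<Rightarrow> 'f::field mat" where
  "adj_matrix H xs =
     mat (length xs) (length xs) (\<lambda>(i, j). if xs ! i \<rightarrow>\<^bsub>H\<^esub> xs ! j then 1 else 0)"

definition shifted_adj_matrix ::
    "('a, 'b) pre_digraph \<Rightarrow> 'a list \<Rightarrow> 'f::field \<Rightarrow> 'f mat" where
  "shifted_adj_matrix H xs lam = adj_matrix H xs - lam \<cdot>\<^sub>m 1\<^sub>m (length xs)"

end

theory Submission
  imports Defs
begin

text \<open>
  Let \<open>f\<close> be a propagator with finite support and let \<open>X\<close> be its support together with \<open>v\<close>.
  If a finite vertex set \<open>X'\<close> contains \<open>X\<close>, then passing from the whole graph to the subgraph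
  induced by \<open>X'\<close> loses only neighbours at which \<open>f\<close> vanishes, so the restriction of \<open>f\<close> to \<open>X'\<close>
  solves the finite linear system with matrix \<open>A - lam E\<close> of that subgraph and right-hand side
  the unit vector at \<open>v\<close> (\<open>propagator_solves_induced_system\<close>).  Cramer's rule
  (\<open>cofactor_eq_det_mult_solution\<close>) says that the cofactors along the row of \<open>v\<close> are then the
  values of \<open>f\<close> multiplied by the determinant, and outside \<open>X\<close> these values are zero.
\<close>

text \<open>
  Cramer's rule for a unit vector on the right-hand side, without dividing by the determinant:
  multiply \<open>A x = e\<^sub>i\<close> by the adjugate from the left and read off entry \<open>j\<close>.  In this form it
  also holds for singular matrices.
\<close>

lemma cofactor_eq_det_mult_solution:
  fixes A :: "'f::comm_ring_1 mat"
  assumes A: "A \<in> carrier_mat n n" and x: "x \<in> carrier_vec n"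
    and sol: "A *\<^sub>v x = unit_vec n i" and i: "i < n" and j: "j < n"
  shows "cofactor A i j = det A * x $ j"
proof -
  have adj: "adj_mat A \<in> carrier_mat n n" "adj_mat A * A = det A \<cdot>\<^sub>m 1\<^sub>m n"
    using adj_mat[OF A] by auto
  have "adj_mat A *\<^sub>v unit_vec n i = (adj_mat A * A) *\<^sub>v x"
    unfolding sol[symmetric] using adj(1) A x by (simp add: assoc_mult_mat_vec)
  also have "\<dots> = det A \<cdot>\<^sub>v x"
    unfolding adj(2) using x by (intro eq_vecI) auto
  finally have "(adj_mat A *\<^sub>v unit_vec n i) $ j = det A * x $ j"
    using x j by simp
  moreover have "(adj_mat A *\<^sub>v unit_vec n i) $ j = adj_mat A $$ (j, i)"
    using adj(1) i j by simp
  moreover have "adj_mat A $$ (j, i) = cofactor A i j"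
    using A i j by (simp add: adj_mat_def)
  ultimately show ?thesis by simp
qed

lemma dominates_induce_subgraph_iff:
  assumes "u \<in> S" "w \<in> S"
  shows "u \<rightarrow>\<^bsub>G \<restriction> S\<^esub> w \<longleftrightarrow> u \<rightarrow>\<^bsub>G\<^esub> w"
  using assms by (auto simp: arcs_ends_conv)

lemma sum_enumerates:
  assumes "enumerates xs S"
  shows "(\<Sum>j<length xs. g (xs ! j)) = sum g S"
  using assms unfolding enumerates_def
  by (intro sum.reindex_bij_betw bij_betw_nth) auto

text \<open>
  Cutting the graph down to \<open>S\<close> changes the neighbour sum even at boundary vertices of \<open>S\<close> only by
  values of \<open>f\<close> outside its support, so the propagator equation survives at every vertex of \<open>S\<close>.
\<close>

lemma propagator_solves_induced_system:
  fixes f :: "'a \<Rightarrow> 'f::field"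
  assumes G: "locally_finite_graph G" and f: "propagator G lam v f"
    and S: "finite S" "S \<subseteq> verts G" "supp G f \<subseteq> S" and xs: "enumerates xs S"
    and i: "i < length xs" "xs ! i = v"
  shows "shifted_adj_matrix (G \<restriction> S) xs lam *\<^sub>v vec (length xs) (\<lambda>j. f (xs ! j))
    = unit_vec (length xs) i"
    (is "?A *\<^sub>v ?x = _")
proof (rule eq_vecI)
  have xs': "distinct xs" "set xs = S" using xs by (auto simp: enumerates_def)
  fix k assume "k < dim_vec (unit_vec (length xs) i :: 'f vec)"
  hence k: "k < length xs" by simp
  define u where "u = xs ! k"
  have u: "u \<in> S" "u \<in> verts G" using k xs' S(2) by (auto simp: u_def)
  have "(?A *\<^sub>v ?x) $ k = (\<Sum>j<length xs. ?A $$ (k, j) * f (xs ! j))"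
    using k by (simp add: shifted_adj_matrix_def adj_matrix_def scalar_prod_def lessThan_atLeast0)
  also have "\<dots> = (\<Sum>j<length xs. (if u \<rightarrow>\<^bsub>G\<^esub> xs ! j then f (xs ! j) else 0)
                                 - (if u = xs ! j then lam * f (xs ! j) else 0))"
  proof (rule sum.cong)
    fix j assume "j \<in> {..<length xs}"
    hence j: "j < length xs" by simp
    have "u = xs ! j \<longleftrightarrow> k = j" using xs'(1) j k by (simp add: u_def nth_eq_iff_index_eq)
    moreover have "xs ! k \<rightarrow>\<^bsub>G \<restriction> S\<^esub> xs ! j \<longleftrightarrow> u \<rightarrow>\<^bsub>G\<^esub> xs ! j"
      unfolding u_def using j k xs' by (intro dominates_induce_subgraph_iff) auto
    ultimately show "?A $$ (k, j) * f (xs ! j) = (if u \<rightarrow>\<^bsub>G\<^esub> xs ! j then f (xs ! j) else 0)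
                                 - (if u = xs ! j then lam * f (xs ! j) else 0)"
      using j k by (simp add: shifted_adj_matrix_def adj_matrix_def algebra_simps)
  qed simp
  also have "\<dots> = (\<Sum>w\<in>S. (if u \<rightarrow>\<^bsub>G\<^esub> w then f w else 0) - (if u = w then lam * f w else 0))"
    by (rule sum_enumerates[OF xs])
  also have "\<dots> = (\<Sum>w\<in>S. if u \<rightarrow>\<^bsub>G\<^esub> w then f w else 0) - lam * f u"
    using S(1) u(1) by (simp add: sum_subtractf)
  also have "(\<Sum>w\<in>S. if u \<rightarrow>\<^bsub>G\<^esub> w then f w else 0) = sum f (S \<inter> {w. u \<rightarrow>\<^bsub>G\<^esub> w})"
    using S(1) by (simp add: sum.inter_restrict)
  also have "\<dots> = sum f (neighbours G u)"
    using S(2,3) locally_finite_graph.finite_neighbours[OF G u(2)]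
    by (intro sum.mono_neutral_left) (auto simp: neighbours_def supp_def)
  also have "\<dots> - lam * f u = delta G v u"
  proof -
    have "(\<lambda>w\<in>verts G. adj_op G f w - lam * f w) u = delta G v u"
      using f by (simp add: propagator_def)
    thus ?thesis using u(2) by (simp add: adj_op_def)
  qed
  also have "\<dots> = unit_vec (length xs) i $ k"
    using u(2) k i xs'(1) by (auto simp: delta_def u_def nth_eq_iff_index_eq)
  finally show "(?A *\<^sub>v ?x) $ k = unit_vec (length xs) i $ k" .
qed (simp add: shifted_adj_matrix_def adj_matrix_def)

theorem mainTheorem13:
  fixes G :: "('a, 'b) pre_digraph"
    and absv :: "'f::field \<Rightarrow> real"
    and v :: 'a
    and lam :: 'f
  assumes "locally_finite_graph G"
    and "absolute_value absv"
    and "v \<in> verts G"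
    and "\<exists>f. propagator G lam v f \<and> finite (supp G f)"
  shows "\<exists>X. finite X \<and> X \<subseteq> verts G \<and> v \<in> X \<and>
    (\<forall>X'. finite X' \<and> X' \<subseteq> verts G \<and> X \<subseteq> X' \<longrightarrow>
      (\<forall>xs. enumerates xs X' \<longrightarrow>
        det (shifted_adj_matrix (G \<restriction> X') xs lam) = 0 \<or>
        (\<forall>i<length xs. \<forall>j<length xs. xs ! i = v \<and> xs ! j \<in> X' - X \<longrightarrow>
          det (mat_delete (shifted_adj_matrix (G \<restriction> X') xs lam) i j) = 0)))"
proof -
  obtain f where f: "propagator G lam v f" "finite (supp G f)" using assms(4) by blast
  define X where "X = insert v (supp G f)"
  have "det (mat_delete (shifted_adj_matrix (G \<restriction> X') xs lam) i j) = 0"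
    if X': "finite X'" "X' \<subseteq> verts G" "X \<subseteq> X'" and xs: "enumerates xs X'"
      and i: "i < length xs" "xs ! i = v" and j: "j < length xs" "xs ! j \<in> X' - X"
    for X' xs i j
  proof -
    let ?A = "shifted_adj_matrix (G \<restriction> X') xs lam"
    have A: "?A \<in> carrier_mat (length xs) (length xs)"
      by (rule carrier_matI) (simp_all add: shifted_adj_matrix_def adj_matrix_def)
    let ?x = "vec (length xs) (\<lambda>j. f (xs ! j))"
    have "?A *\<^sub>v ?x = unit_vec (length xs) i"
      using X' by (intro propagator_solves_induced_system[OF assms(1) f(1) _ _ _ xs i])
        (auto simp: X_def)
    with A have "cofactor ?A i j = det ?A * ?x $ j"
      by (rule cofactor_eq_det_mult_solution[OF _ vec_carrier _ i(1) j(1)])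
    also have "?x $ j = f (xs ! j)"
      using j(1) by simp
    also have "f (xs ! j) = 0"
      using j(2) X'(2) by (auto simp: X_def supp_def)
    finally show ?thesis by (simp add: cofactor_def)
  qed
  moreover have "finite X" "X \<subseteq> verts G" "v \<in> X"
    using f(2) assms(3) by (auto simp: X_def supp_def)
  ultimately show ?thesis
    by (intro exI[of _ X] conjI allI impI disjI2) auto
qed

end
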